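(* Let $n\ge 1$ and let $\pi=(a_1,b_1)(a_2,b_2)\cdots(a_k,b_k)\in\mathscr{I}_n$ be an involution written in standard form, with fixed points $c_1<c_2<\dots<c_l$. Then $\mathcal{W}(\pi)$ consists exactly of those permutations $w=[w(1),w(2),\dots,w(n)]\in S_n$ such that all of the following hold: (1) for each $1\le i\le k$, $b_i$ occurs before $a_i$ in $w$, and for any $x$ with $a_i<x<b_i$, $x$ does not occur between $b_i$ and $a_i$ in $w$; (2) if $i<j$ and $b_i<b_j$, then $a_i$ occurs before $b_j$ in $w$; (3) if $i<j$, then $c_i$ occurs before $c_j$ in $w$; (4) if $c_j<a_i$, then $c_j$ occurs before $b_i$ in $w$; (5) if $b_i<c_j$, then $a_i$ occurs before $c_j$ in $w$.
   Context: Permutations are written in one-line notation $w=[w(1),\dots,w(n)]$ and multiplied by composition from right to left; $s_i=(i,i+1)$ is the simple transposition and $\ell(w)$ is the Coxeter length (number of inversions). For $w\in S_n$ and $x,y\in[n]$, "$x$ occurs before $y$ in $w$" means $w^{-1}(x)<w^{-1}(y)$; "between" is defined similarly. $\mathscr{I}_n=\{\pi\in S_n:\pi^2=\mathrm{id}\}$. An involution $\pi=(a_1,b_1)\cdots(a_k,b_k)$ (product of disjoint transpositions) is in standard form if $a_i<b_i$ for all $i$ and $a_1<\dots<a_k$. For $\pi\in\mathscr{I}_n$ with $k$ two-cycles, set $L(\pi)=(\ell(\pi)+k)/2$. For $1\le i\le n-1$ and $\pi\in\mathscr{I}_n$ define $m(s_i)\cdot\pi=s_i\pi s_i$ if $\ell(s_i\pi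 s_i)=\ell(\pi)+2$; $m(s_i)\cdot\pi=s_i\pi$ if $\pi(i)=i$ and $\pi(i+1)=i+1$; and $m(s_i)\cdot\pi=\pi$ otherwise. These operators satisfy $m(s_i)^2=m(s_i)$ and the braid relations, so they define an action of the Richardson–Springer monoid; for $w\in S_n$ with any reduced expression $w=s_{i_1}\cdots s_{i_r}$ put $m(w)\cdot\pi=m(s_{i_1})\cdot(m(s_{i_2})\cdot(\cdots m(s_{i_r})\cdot\pi))$, which is independent of the reduced expression. The $\mathcal{W}$-set of $\pi\in\mathscr{I}_n$ is $\mathcal{W}(\pi)=\{w\in S_n: m(w)\cdot\mathrm{id}=\pi\text{ and }\ell(w)=L(\pi)\}$. *)

theory Defs
  imports Complex_Main "HOL-Combinatorics.Permutations"
begin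

text \<open>
  The symmetric group on \<open>[n]\<close> is rendered as the functions \<open>w :: nat \<Rightarrow> nat\<close> with
  \<open>w permutes {1..n}\<close>; they are the identity outside \<open>{1..n}\<close>. The one-line notation is
  \<open>[w 1, \<dots>, w n]\<close>, and the product \<open>u v\<close> is \<open>u \<circ> v\<close>.
\<close>

definition simple_transp :: "nat \<Rightarrow> nat \<Rightarrow> nat" where
  "simple_transp i = transpose i (i + 1)"

definition coxeter_length :: "nat \<Rightarrow> (nat \<Rightarrow> nat) \<Rightarrow> nat" where
  "coxeter_length n w = card {(i, j). 1 \<le> i \<and> i < j \<and> j \<le> n \<and> w j < w i}"

definition involutions :: "nat \<Rightarrow> (nat \<Rightarrow> nat) set" where
  "involutions n = {\<pi>. \<pi> permutes {1..n} \<and> \<pi> \<circ> \<pi> = id}"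

definition two_cycles :: "nat \<Rightarrow> (nat \<Rightarrow> nat) \<Rightarrow> nat set set" where
  "two_cycles n \<pi> = {{x, y} | x y. x \<in> {1..n} \<and> y \<in> {1..n} \<and> x \<noteq> y \<and> \<pi> x = y \<and> \<pi> y = x}"

definition L_stat :: "nat \<Rightarrow> (nat \<Rightarrow> nat) \<Rightarrow> rat" where
  "L_stat n \<pi> = (of_nat (coxeter_length n \<pi>) + of_nat (card (two_cycles n \<pi>))) / 2"

definition m_simple :: "nat \<Rightarrow> nat \<Rightarrow> (nat \<Rightarrow> nat) \<Rightarrow> (nat \<Rightarrow> nat)" where
  "m_simple n i \<pi> =
     (if coxeter_length n (simple_transp i \<circ> \<pi> \<circ> simple_transp i) = coxeter_length n \<pi> + 2
      then simple_transp i \<circ> \<pi> \<circ> simple_transp i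
      else if \<pi> i = i \<and> \<pi> (i + 1) = i + 1 then simple_transp i \<circ> \<pi>
      else \<pi>)"

definition word_prod :: "nat list \<Rightarrow> (nat \<Rightarrow> nat)" where
  "word_prod is = foldr (\<lambda>i u. simple_transp i \<circ> u) is id"

definition reduced_word :: "nat \<Rightarrow> (nat \<Rightarrow> nat) \<Rightarrow> nat list \<Rightarrow> bool" where
  "reduced_word n w is \<longleftrightarrow>
     set is \<subseteq> {1..<n} \<and> word_prod is = w \<and> length is = coxeter_length n w"

text \<open>
  The result does not depend on the reduced word, because the operators \<open>m_simple n i\<close>
  satisfy the braid relations on \<open>involutions n\<close>; so an arbitrary reduced word is chosen.
\<close>

definition m_act :: "nat \<Rightarrow> (nat \<Rightarrow> nat) \<Rightarrow> (nat \<Rightarrow> nat) \<Rightarrow> (nat \<Rightarrow> nat)" where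
  "m_act n w \<pi> = foldr (m_simple n) (SOME is. reduced_word n w is) \<pi>"

definition W_set :: "nat \<Rightarrow> (nat \<Rightarrow> nat) \<Rightarrow> (nat \<Rightarrow> nat) set" where
  "W_set n \<pi> =
     {w. w permutes {1..n} \<and> m_act n w id = \<pi> \<and> of_nat (coxeter_length n w) = L_stat n \<pi>}"

text \<open>
  Only the values of \<open>a\<close> and \<open>b\<close> on \<open>{1..k}\<close> are relevant. The two-cycles
  \<open>(a i, b i)\<close> are pairwise disjoint: \<open>a\<close> is injective by monotonicity.
\<close>

definition standard_form ::
  "nat \<Rightarrow> (nat \<Rightarrow> nat) \<Rightarrow> nat \<Rightarrow> (nat \<Rightarrow> nat) \<Rightarrow> (nat \<Rightarrow> nat) \<Rightarrow> bool" where
  "standard_form n \<pi> k a b \<longleftrightarrow>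
     a ` {1..k} \<subseteq> {1..n} \<and> b ` {1..k} \<subseteq> {1..n} \<and>
     (\<forall>i\<in>{1..k}. a i < b i) \<and> strict_mono_on {1..k} a \<and>
     inj_on b {1..k} \<and> a ` {1..k} \<inter> b ` {1..k} = {} \<and>
     \<pi> = foldr (\<lambda>i u. transpose (a i) (b i) \<circ> u) [1..<k + 1] id"

definition fixed_points_listed ::
  "nat \<Rightarrow> (nat \<Rightarrow> nat) \<Rightarrow> nat \<Rightarrow> (nat \<Rightarrow> nat) \<Rightarrow> bool" where
  "fixed_points_listed n \<pi> l c \<longleftrightarrow>
     strict_mono_on {1..l} c \<and> c ` {1..l} = {x \<in> {1..n}. \<pi> x = x}"

definition occurs_before :: "(nat \<Rightarrow> nat) \<Rightarrow> nat \<Rightarrow> nat \<Rightarrow> bool" where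
  "occurs_before w x y \<longleftrightarrow> inv w x < inv w y"

text \<open>\<open>occurs_between w x y z\<close>: \<open>x\<close> occurs between \<open>y\<close> and \<open>z\<close>, in either order of \<open>y\<close> and \<open>z\<close>.\<close>

definition occurs_between :: "(nat \<Rightarrow> nat) \<Rightarrow> nat \<Rightarrow> nat \<Rightarrow> nat \<Rightarrow> bool" where
  "occurs_between w x y z \<longleftrightarrow>
     (occurs_before w y x \<and> occurs_before w x z) \<or> (occurs_before w z x \<and> occurs_before w x y)"

end

theory Submission
  imports Defs
begin

text \<open>
  Treat a fixed point as a cycle with \<open>a = b\<close>; then the conditions (2)-(5) become one condition on
  pairs of cycles, and (1)-(5) turn into a predicate \<open>W_cond \<pi> w\<^sup>-\<^sup>1\<close>. Suppose \<open>w = s\<^sub>i u\<close> with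
  \<open>\<ell>(w) = \<ell>(u) + 1\<close>. If \<open>\<sigma>(i) < \<sigma>(i + 1)\<close> and \<open>\<pi> = m(s\<^sub>i) \<cdot> \<sigma>\<close>, then the conditions for \<open>(\<sigma>, u)\<close> and
  for \<open>(\<pi>, w)\<close> are equivalent, and \<open>L(\<pi>) = L(\<sigma>) + 1\<close>. Conversely, the conditions for \<open>(\<pi>, w)\<close>
  force \<open>\<pi>(i) > \<pi>(i + 1)\<close>, so that \<open>\<pi> = m(s\<^sub>i) \<cdot> \<sigma>\<close> for such a \<open>\<sigma>\<close>. Induction along an arbitrary
  reduced word of \<open>w\<close> gives the theorem, without any appeal to the braid relations.
\<close>

subsection \<open>Length and reduced words\<close>

lemma simple_transp_eq: "simple_transp i = transpose i (Suc i)"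
  by (simp add: simple_transp_def)

lemma simple_transp_simps [simp]:
  "simple_transp i i = Suc i"
  "simple_transp i (Suc i) = i"
  "simple_transp i (simple_transp i x) = x"
  "simple_transp i \<circ> simple_transp i = id"
  "x \<noteq> i \<Longrightarrow> x \<noteq> Suc i \<Longrightarrow> simple_transp i x = x"
  by (simp_all add: simple_transp_eq)

lemma bij_simple_transp: "bij (simple_transp i)"
  by (simp add: simple_transp_eq)

lemma inv_simple_transp [simp]: "inv (simple_transp i) = simple_transp i"
  by (simp add: simple_transp_eq)

lemma simple_transp_eq_iff [simp]: "simple_transp i x = simple_transp i y \<longleftrightarrow> x = y"
  by (metis simple_transp_simps(3))

text \<open>A simple transposition is monotone except on the pair \<open>i\<close>,
  \<open>Suc i\<close>. Comparing orders before and after a step thus comes down to this exceptional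
  pair.\<close>

lemma simple_transp_less_iff:
  "simple_transp i x < simple_transp i y \<longleftrightarrow> (x < y \<and> (x, y) \<noteq> (i, Suc i)) \<or> (x, y) = (Suc i, i)"
  by (auto simp: simple_transp_eq transpose_def)

lemma simple_transp_permutes:
  assumes "i \<in> {1..<n}" shows "simple_transp i permutes {1..n}"
  using assms by (auto simp: simple_transp_eq intro!: permutes_swap_id)

text \<open>The transposition is its own inverse, so it may be substituted into a bound variable.
  This moves a conjugation out of the cycles and into the order comparisons.\<close>

lemma all_simple_transp: "(\<forall>x. F x) \<longleftrightarrow> (\<forall>x. F (simple_transp i x))"
  by (metis simple_transp_simps(3))

lemma ex_simple_transp: "(\<exists>x. F x) \<longleftrightarrow> (\<exists>x. F (simple_transp i x))"
  by (metis simple_transp_simps(3))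

section \<open>Inversions, and length under multiplication by \<open>simple_transp i\<close>\<close>

definition inversions :: "nat \<Rightarrow> (nat \<Rightarrow> nat) \<Rightarrow> (nat \<times> nat) set" where
  "inversions n w = {(p, q). 1 \<le> p \<and> p < q \<and> q \<le> n \<and> w q < w p}"

lemma finite_inversions: "finite (inversions n w)"
  by (rule finite_subset[of _ "{1..n} \<times> {1..n}"]) (auto simp: inversions_def)

lemma coxeter_length_inversions: "coxeter_length n w = card (inversions n w)"
  by (simp add: coxeter_length_def inversions_def)

lemma coxeter_length_id [simp]: "coxeter_length n id = 0"
proof -
  have "inversions n id = {}" by (auto simp: inversions_def)
  then show ?thesis by (simp add: coxeter_length_inversions)
qed

text \<open>Exchanging positions and values matches the inversions of \<open>v\<close> with those of
  \<open>inv v\<close>. One inequality suffices, because it can be applied to both \<open>w\<close>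
  and \<open>inv w\<close>.\<close>

lemma coxeter_length_inv:
  assumes "w permutes {1..n}"
  shows "coxeter_length n (inv w) = coxeter_length n w"
proof -
  have le: "card (inversions n (inv v)) \<le> card (inversions n v)" if v: "v permutes {1..n}" for v
  proof (rule surj_card_le[OF finite_inversions])
    show "inversions n (inv v) \<subseteq> (\<lambda>(p, q). (v q, v p)) ` inversions n v"
    proof
      fix z assume "z \<in> inversions n (inv v)"
      then obtain p q where z: "z = (p, q)" and pq: "1 \<le> p" "p < q" "q \<le> n" "inv v q < inv v p"
        by (auto simp: inversions_def)
      have "inv v q \<in> {1..n}" "inv v p \<in> {1..n}"
        unfolding permutes_in_image[OF permutes_inv[OF v]] using pq by auto
      then have "(inv v q, inv v p) \<in> inversions n v"
        using pq by (simp add: inversions_def permutes_inverses[OF v])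
      then show "z \<in> (\<lambda>(p, q). (v q, v p)) ` inversions n v"
        by (rule rev_image_eqI) (simp add: z permutes_inverses[OF v])
    qed
  qed
  from le[OF assms] le[OF permutes_inv[OF assms]] show ?thesis
    by (simp add: coxeter_length_inversions permutes_inv_inv[OF assms])
qed

text \<open>Relabelling the positions \<open>i\<close> and \<open>Suc i\<close> carries old
  inversions to new ones; the only extra inversion is the pair \<open>(i, Suc i)\<close>
  itself.\<close>

lemma coxeter_length_comp_simple_transp_ascent:
  assumes i: "i \<in> {1..<n}" and asc: "w i < w (Suc i)"
  shows "coxeter_length n (w \<circ> simple_transp i) = Suc (coxeter_length n w)"
proof -
  let ?s = "simple_transp i"
  have rng: "1 \<le> ?s x \<and> ?s x \<le> n \<longleftrightarrow> 1 \<le> x \<and> x \<le> n" for x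
    using i by (auto simp: simple_transp_eq transpose_def)
  have eq: "inversions n (w \<circ> ?s) = insert (i, Suc i) (map_prod ?s ?s ` inversions n w)"
  proof (rule set_eqI, clarify)
    fix p q
    have "(p, q) \<in> map_prod ?s ?s ` inversions n w \<longleftrightarrow> (?s p, ?s q) \<in> inversions n w"
      by (force simp: image_iff)
    also have "\<dots> \<longleftrightarrow> p \<in> {1..n} \<and> q \<in> {1..n} \<and> ?s p < ?s q \<and> w (?s q) < w (?s p)"
      using rng[of p] rng[of q] unfolding inversions_def by force
    finally have image: "(p, q) \<in> map_prod ?s ?s ` inversions n w
      \<longleftrightarrow> p \<in> {1..n} \<and> q \<in> {1..n} \<and> ?s p < ?s q \<and> w (?s q) < w (?s p)" .
    consider "p = i" "q = Suc i" | "p = Suc i" "q = i"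
      | "(p, q) \<noteq> (i, Suc i)" "?s p < ?s q \<longleftrightarrow> p < q"
      unfolding simple_transp_less_iff by blast
    then show "(p, q) \<in> inversions n (w \<circ> ?s)
        \<longleftrightarrow> (p, q) \<in> insert (i, Suc i) (map_prod ?s ?s ` inversions n w)"
    proof cases
      case 1
      then show ?thesis using asc i by (simp add: inversions_def)
    next
      case 2
      then show ?thesis unfolding insert_iff image using asc by (simp add: inversions_def)
    next
      case 3
      then show ?thesis unfolding insert_iff image by (auto simp: inversions_def)
    qed
  qed
  \<comment> \<open>The preimage would be \<open>(Suc i, i)\<close>, which is not an increasing pair
    of positions.\<close>
  have "(i, Suc i) \<notin> map_prod ?s ?s ` inversions n w"
    by (auto simp: inversions_def) (metis less_not_sym lessI simple_transp_simps(1-3))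
  moreover have "inj_on (map_prod ?s ?s) (inversions n w)"
    by (auto simp: inj_on_def)
  ultimately show ?thesis
    by (simp add: coxeter_length_inversions eq finite_inversions card_image)
qed

lemma coxeter_length_comp_simple_transp_descent:
  assumes i: "i \<in> {1..<n}" and desc: "w (Suc i) < w i"
  shows "Suc (coxeter_length n (w \<circ> simple_transp i)) = coxeter_length n w"
  using coxeter_length_comp_simple_transp_ascent[of i n "w \<circ> simple_transp i"] assms
  by (simp add: comp_assoc)

text \<open>Inverting turns left multiplication into right multiplication. The hypotheses compare
  positions: \<open>inv w i < inv w (Suc i)\<close> says that \<open>i\<close> stands before
  \<open>Suc i\<close> in one-line notation.\<close>

lemma coxeter_length_simple_transp_comp:
  assumes i: "i \<in> {1..<n}" and w: "w permutes {1..n}"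
  shows "inv w i < inv w (Suc i) \<Longrightarrow> coxeter_length n (simple_transp i \<circ> w) = Suc (coxeter_length n w)"
    and "inv w (Suc i) < inv w i \<Longrightarrow> Suc (coxeter_length n (simple_transp i \<circ> w)) = coxeter_length n w"
proof -
  have "inv (simple_transp i \<circ> w) = inv w \<circ> simple_transp i"
    by (simp add: o_inv_distrib bij_simple_transp permutes_bij[OF w])
  then have *: "coxeter_length n (simple_transp i \<circ> w) = coxeter_length n (inv w \<circ> simple_transp i)"
    using coxeter_length_inv[of "simple_transp i \<circ> w" n]
      permutes_compose[OF w simple_transp_permutes[OF i]] by simp
  show "inv w i < inv w (Suc i) \<Longrightarrow> coxeter_length n (simple_transp i \<circ> w) = Suc (coxeter_length n w)"
    using coxeter_length_comp_simple_transp_ascent[OF i, of "inv w"]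
    by (simp add: * coxeter_length_inv[OF w])
  show "inv w (Suc i) < inv w i \<Longrightarrow> Suc (coxeter_length n (simple_transp i \<circ> w)) = coxeter_length n w"
    using coxeter_length_comp_simple_transp_descent[OF i, of "inv w"]
    by (simp add: * coxeter_length_inv[OF w])
qed

text \<open>Counting up from \<open>v 1 \<ge> 1\<close> gives \<open>v j \<ge> j\<close>, and
  counting down from \<open>v n \<le> n\<close> gives \<open>v j \<le> j\<close>.\<close>

lemma permutes_ascending_eq_id:
  fixes v :: "nat \<Rightarrow> nat"
  assumes v: "v permutes {1..n}" and asc: "\<And>i. i \<in> {1..<n} \<Longrightarrow> v i < v (Suc i)"
  shows "v = id"
proof -
  have up: "j \<le> v j" if "j \<le> n" for j
    using that
  proof (induction j)
    case (Suc j)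
    show ?case
    proof (cases "j = 0")
      case True
      then show ?thesis using permutes_in_image[OF v, of "Suc j"] Suc.prems by auto
    next
      case False
      then show ?thesis using Suc asc[of j] by auto
    qed
  qed simp
  have down: "v j \<le> j" if "1 \<le> j" "j \<le> n" for j
    using \<open>j \<le> n\<close> \<open>1 \<le> j\<close>
  proof (induction j rule: inc_induct)
    case base
    then show ?case using permutes_in_image[OF v, of n] by auto
  next
    case (step j)
    then show ?case using asc[of j] by auto
  qed
  show ?thesis
  proof
    fix x show "v x = id x"
      using up[of x] down[of x] permutes_not_in[OF v, of x] by (cases "x \<in> {1..n}") auto
  qed
qed

section \<open>Words and reduced words\<close>

lemma word_prod_simps [simp]:
  "word_prod [] = id" "word_prod (i # is) = simple_transp i \<circ> word_prod is"
  by (simp_all add: word_prod_def)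

lemma word_prod_permutes: "set is \<subseteq> {1..<n} \<Longrightarrow> word_prod is permutes {1..n}"
proof (induction "is")
  case (Cons i "is")
  then have "word_prod is permutes {1..n}" "i \<in> {1..<n}" by auto
  then show ?case
    unfolding word_prod_simps by (intro permutes_compose simple_transp_permutes)
qed (simp add: permutes_id)

lemma inv_neq:
  assumes "w permutes S" shows "inv w i \<noteq> inv w (Suc i)"
  using assms by (metis n_not_Suc_n permutes_inverses(1))

lemma coxeter_length_word_prod_le:
  "set is \<subseteq> {1..<n} \<Longrightarrow> coxeter_length n (word_prod is) \<le> length is"
proof (induction "is")
  case (Cons i "is")
  then have p: "word_prod is permutes {1..n}" and i: "i \<in> {1..<n}"
    using word_prod_permutes[of "is" n] by simp_all
  have le: "coxeter_length n (word_prod is) \<le> length is"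
    by (rule Cons.IH) (use Cons.prems in simp)
  show ?case
    unfolding word_prod_simps list.size
    using coxeter_length_simple_transp_comp[OF i p] inv_neq[OF p, of i] le by linarith
qed simp

text \<open>The product of the tail cannot be longer than the number of its letters, so the first
  letter must raise the length. This settles the relative order of \<open>i\<close> and
  \<open>Suc i\<close> in the tail and keeps the tail reduced.\<close>

lemma reduced_word_Cons:
  assumes "reduced_word n w (i # is)"
  shows "i \<in> {1..<n}" "reduced_word n (word_prod is) is" "w = simple_transp i \<circ> word_prod is"
    "inv (word_prod is) i < inv (word_prod is) (Suc i)"
proof -
  let ?u = "word_prod is"
  show i: "i \<in> {1..<n}" and w: "w = simple_transp i \<circ> ?u"
    using assms by (auto simp: reduced_word_def)
  have s: "set is \<subseteq> {1..<n}" using assms by (auto simp: reduced_word_def)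
  note p = word_prod_permutes[OF s]
  have len: "coxeter_length n w = Suc (length is)" using assms by (simp add: reduced_word_def)
  have le: "coxeter_length n ?u \<le> length is" by (rule coxeter_length_word_prod_le[OF s])
  show "inv ?u i < inv ?u (Suc i)"
    using coxeter_length_simple_transp_comp(2)[OF i p] inv_neq[OF p, of i] len le w
    by (metis Suc_n_not_le_n linorder_neqE_nat le_SucI)
  with coxeter_length_simple_transp_comp(1)[OF i p] len w s show "reduced_word n ?u is"
    by (simp add: reduced_word_def)
qed

text \<open>Sorting: as long as some \<open>Suc i\<close> stands before \<open>i\<close>, exchanging
  them shortens the permutation, and only the identity has no such pair.\<close>

lemma reduced_word_exists:
  assumes "w permutes {1..n}" shows "\<exists>is. reduced_word n w is"
  using assms
proof (induction "coxeter_length n w" arbitrary: w rule: less_induct)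
  case less
  show ?case
  proof (cases "\<forall>i\<in>{1..<n}. inv w i < inv w (Suc i)")
    case True
    then have "inv w = id" using permutes_ascending_eq_id[OF permutes_inv[OF less.prems]] by blast
    then have "w = id" using permutes_inv_inv[OF less.prems] by simp
    then have "reduced_word n w []" by (simp add: reduced_word_def)
    then show ?thesis ..
  next
    case False
    then obtain i where i: "i \<in> {1..<n}" and "inv w (Suc i) < inv w i"
      using inv_neq[OF less.prems] by (metis linorder_neqE_nat)
    then have len: "Suc (coxeter_length n (simple_transp i \<circ> w)) = coxeter_length n w"
      using coxeter_length_simple_transp_comp(2)[OF i less.prems] by blast
    obtain "is" where "reduced_word n (simple_transp i \<circ> w) is"
      using less.hyps[of "simple_transp i \<circ> w"] len
        permutes_compose[OF less.prems simple_transp_permutes[OF i]] by auto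
    then have "reduced_word n w (i # is)"
      using i len by (simp add: reduced_word_def flip: comp_assoc)
    then show ?thesis ..
  qed
qed

subsection \<open>The action on involutions\<close>

lemma involutionsD:
  assumes "\<sigma> \<in> involutions n"
  shows "\<sigma> permutes {1..n}" "\<sigma> (\<sigma> x) = x" "inv \<sigma> = \<sigma>" "\<sigma> x = \<sigma> y \<longleftrightarrow> x = y"
proof -
  show "\<sigma> permutes {1..n}" and *: "\<And>x. \<sigma> (\<sigma> x) = x" using assms
    by (simp_all add: involutions_def fun_eq_iff)
  show "inv \<sigma> = \<sigma>" using assms by (simp add: involutions_def inv_unique_comp)
  show "\<sigma> x = \<sigma> y \<longleftrightarrow> x = y" by (metis *)
qed

lemma id_in_involutions: "id \<in> involutions n"
  by (simp add: involutions_def permutes_id)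

lemma conj_simple_transp_involution:
  assumes "i \<in> {1..<n}" "\<sigma> \<in> involutions n"
  shows "simple_transp i \<circ> \<sigma> \<circ> simple_transp i \<in> involutions n"
proof -
  note s = simple_transp_permutes[OF assms(1)]
  show ?thesis
    using permutes_compose[OF permutes_compose[OF s involutionsD(1)[OF assms(2)]] s]
    by (simp add: involutions_def fun_eq_iff involutionsD(2)[OF assms(2)] comp_assoc)
qed

text \<open>If \<sigma> preserves \<open>{i, Suc i}\<close>, it commutes with the transposition.
  Both fixing and exchanging the two points are allowed, so the lemma serves for creating the cycle
  and for removing it.\<close>

lemma simple_transp_comp_involution:
  assumes "i \<in> {1..<n}" "\<sigma> \<in> involutions n" "\<sigma> i \<in> {i, Suc i}" "\<sigma> (Suc i) \<in> {i, Suc i}"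
  shows "simple_transp i \<circ> \<sigma> \<in> involutions n"
proof -
  note D = involutionsD[OF assms(2)]
  have "simple_transp i (\<sigma> (simple_transp i (\<sigma> x))) = x" for x
  proof (cases "\<sigma> x \<in> {i, Suc i}")
    case True
    then show ?thesis using assms(3,4) D by (metis insertE simple_transp_simps(1,2) singletonD)
  next
    case False
    then have "x \<notin> {i, Suc i}" using assms(3,4) by auto
    with False show ?thesis using D by simp
  qed
  then show ?thesis
    using permutes_compose[OF D(1) simple_transp_permutes[OF assms(1)]]
    by (simp add: involutions_def fun_eq_iff)
qed

text \<open>An involution sending \<open>i\<close> to \<open>Suc i\<close> also sends
  \<open>Suc i\<close> to \<open>i\<close>, which would be a descent. So the values at
  \<open>i\<close> and \<open>Suc i\<close> are not a pair that the transposition reverses.\<close>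

lemma involution_swap_pair:
  assumes "\<sigma> \<in> involutions n" "\<sigma> i < \<sigma> (Suc i)" "\<not> (\<sigma> i = i \<and> \<sigma> (Suc i) = Suc i)"
  shows "(\<sigma> i, \<sigma> (Suc i)) \<noteq> (i, Suc i)" "\<sigma> i \<noteq> Suc i" "\<sigma> (Suc i) \<noteq> i"
  using assms involutionsD(2)[OF assms(1), of i] involutionsD(2)[OF assms(1), of "Suc i"] by auto

text \<open>Each of the two multiplications adds one inversion. The left one needs the ascent to
  survive transposing the values, which it fails to do only if both points are fixed.\<close>

lemma coxeter_length_conj:
  assumes i: "i \<in> {1..<n}" and \<sigma>: "\<sigma> \<in> involutions n"
    and asc: "\<sigma> i < \<sigma> (Suc i)" and nf: "\<not> (\<sigma> i = i \<and> \<sigma> (Suc i) = Suc i)"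
  shows "coxeter_length n (simple_transp i \<circ> \<sigma> \<circ> simple_transp i) = coxeter_length n \<sigma> + 2"
proof -
  let ?s = "simple_transp i"
  note D = involutionsD[OF \<sigma>]
  have p: "\<sigma> \<circ> ?s permutes {1..n}"
    using permutes_compose[OF simple_transp_permutes[OF i] D(1)] .
  have "inv (\<sigma> \<circ> ?s) = ?s \<circ> \<sigma>"
    by (simp add: o_inv_distrib bij_simple_transp permutes_bij[OF D(1)] D(3))
  moreover have "?s (\<sigma> i) < ?s (\<sigma> (Suc i))"
    using asc involution_swap_pair[OF \<sigma> asc nf] by (auto simp: simple_transp_less_iff)
  ultimately show ?thesis
    using coxeter_length_simple_transp_comp(1)[OF i p]
      coxeter_length_comp_simple_transp_ascent[OF i, of \<sigma>] asc
    by (simp add: comp_assoc)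
qed

text \<open>Replaces the length test in the definition by a comparison of two values, the form in
  which all later arguments use the operator.\<close>

lemma m_simple_eq:
  assumes i: "i \<in> {1..<n}" and \<sigma>: "\<sigma> \<in> involutions n"
  shows "m_simple n i \<sigma> =
    (if \<sigma> i < \<sigma> (Suc i)
     then if \<sigma> i = i \<and> \<sigma> (Suc i) = Suc i then simple_transp i \<circ> \<sigma>
          else simple_transp i \<circ> \<sigma> \<circ> simple_transp i
     else \<sigma>)"
proof -
  let ?s = "simple_transp i"
  note D = involutionsD[OF \<sigma>]
  consider "\<sigma> i < \<sigma> (Suc i)" "\<not> (\<sigma> i = i \<and> \<sigma> (Suc i) = Suc i)"
    | "\<sigma> i = i" "\<sigma> (Suc i) = Suc i" | "\<sigma> (Suc i) < \<sigma> i"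
    using D(4)[of i "Suc i"] by linarith
  then show ?thesis
  proof cases
    case 1
    then show ?thesis using coxeter_length_conj[OF i \<sigma> 1] by (auto simp: m_simple_def)
  next
    case 2
    \<comment> \<open>Here \<sigma> commutes with the transposition, so conjugation changes nothing
      and the length test fails.\<close>
    have "?s (\<sigma> (?s x)) = \<sigma> x" for x
    proof (cases "x \<in> {i, Suc i}")
      case False
      then have "\<sigma> x \<notin> {i, Suc i}" using 2 D(4) by (metis insert_iff singletonD)
      with False show ?thesis by simp
    qed (use 2 in auto)
    then have "?s \<circ> \<sigma> \<circ> ?s = \<sigma>" by (simp add: fun_eq_iff)
    then show ?thesis using 2 by (simp add: m_simple_def)
  next
    case 3
    have p: "\<sigma> \<circ> ?s permutes {1..n}"
      using permutes_compose[OF simple_transp_permutes[OF i] D(1)] .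
    \<comment> \<open>At a descent, right multiplication lowers the length by one and left
      multiplication raises it by at most one.\<close>
    have "coxeter_length n (?s \<circ> \<sigma> \<circ> ?s) \<le> coxeter_length n \<sigma>"
      using coxeter_length_simple_transp_comp[OF i p] inv_neq[OF p, of i]
        coxeter_length_comp_simple_transp_descent[OF i, of \<sigma>] 3
      by (simp add: comp_assoc) (metis Suc_leD Suc_leI lessI linorder_neqE_nat order_refl)
    then show ?thesis using 3 by (auto simp: m_simple_def)
  qed
qed

lemma m_simple_involution:
  assumes "i \<in> {1..<n}" "\<sigma> \<in> involutions n"
  shows "m_simple n i \<sigma> \<in> involutions n"
  unfolding m_simple_eq[OF assms]
  using assms conj_simple_transp_involution[OF assms] simple_transp_comp_involution[OF assms] by auto

text \<open>The inverse step at a descent: if \<pi> exchanges \<open>i\<close> and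
  \<open>Suc i\<close>, that cycle is removed; otherwise \<pi> is conjugated back.\<close>

lemma m_simple_preimage:
  assumes i: "i \<in> {1..<n}" and \<pi>: "\<pi> \<in> involutions n" and desc: "\<pi> (Suc i) < \<pi> i"
  obtains \<sigma> where "\<sigma> \<in> involutions n" "\<sigma> i < \<sigma> (Suc i)" "m_simple n i \<sigma> = \<pi>"
proof -
  let ?s = "simple_transp i"
  note D = involutionsD[OF \<pi>]
  show thesis
  proof (cases "\<pi> i = Suc i")
    case True
    then have T: "\<pi> (Suc i) = i" using D(2)[of i] by simp
    have inv: "?s \<circ> \<pi> \<in> involutions n"
      using simple_transp_comp_involution[OF i \<pi>] True T by simp
    have \<rho>: "(?s \<circ> \<pi>) i = i" "(?s \<circ> \<pi>) (Suc i) = Suc i" using True T by simp_all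
    have "m_simple n i (?s \<circ> \<pi>) = ?s \<circ> (?s \<circ> \<pi>)"
      unfolding m_simple_eq[OF i inv] \<rho> by simp
    also have "\<dots> = \<pi>" by (simp add: fun_eq_iff)
    finally show thesis by (intro that[OF inv]) (simp_all only: \<rho> lessI)
  next
    case False
    then have F: "(\<pi> (Suc i), \<pi> i) \<noteq> (i, Suc i)" by auto
    define \<rho> where "\<rho> = ?s \<circ> \<pi> \<circ> ?s"
    have inv: "\<rho> \<in> involutions n"
      unfolding \<rho>_def by (rule conj_simple_transp_involution[OF i \<pi>])
    have asc: "\<rho> i < \<rho> (Suc i)"
      using desc F by (simp add: \<rho>_def simple_transp_less_iff)
    \<comment> \<open>If \<rho> fixed both points, so would \<pi>, contrary to the descent.\<close>
    have "\<pi> (Suc i) = ?s (\<rho> i)" "\<pi> i = ?s (\<rho> (Suc i))" by (simp_all add: \<rho>_def)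
    then have nf: "\<not> (\<rho> i = i \<and> \<rho> (Suc i) = Suc i)" using desc by auto
    have "m_simple n i \<rho> = ?s \<circ> \<rho> \<circ> ?s"
      unfolding m_simple_eq[OF i inv] using asc nf by (simp only: if_True if_False)
    also have "\<dots> = \<pi>" by (simp add: \<rho>_def fun_eq_iff)
    finally show thesis by (rule that[OF inv asc])
  qed
qed

section \<open>Two-cycles and the doubled statistic\<close>

lemma two_cycles_alt:
  assumes "\<sigma> \<in> involutions n"
  shows "two_cycles n \<sigma> = {{x, \<sigma> x} | x. \<sigma> x \<noteq> x}"
proof -
  note D = involutionsD[OF assms]
  have in_n: "x \<in> {1..n}" if "\<sigma> x \<noteq> x" for x
    using permutes_not_in[OF D(1)] that by blast
  have "{x, \<sigma> x} \<in> two_cycles n \<sigma>" if "\<sigma> x \<noteq> x" for x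
  proof -
    have "\<sigma> (\<sigma> x) \<noteq> \<sigma> x" using that D(2)[of x] by simp
    with in_n[OF that] in_n[OF this] that D(2)[of x] show ?thesis
      unfolding two_cycles_def by (intro CollectI exI[of _ x] exI[of _ "\<sigma> x"]) simp
  qed
  then show ?thesis by (auto simp: two_cycles_def)
qed

text \<open>The transposition maps the cycles of \<sigma> bijectively onto those of the
  conjugate.\<close>

lemma two_cycles_conj:
  assumes i: "i \<in> {1..<n}" and \<sigma>: "\<sigma> \<in> involutions n"
  shows "card (two_cycles n (simple_transp i \<circ> \<sigma> \<circ> simple_transp i)) = card (two_cycles n \<sigma>)"
proof -
  let ?s = "simple_transp i"
  have "two_cycles n (?s \<circ> \<sigma> \<circ> ?s) = {{x, ?s (\<sigma> (?s x))} | x. ?s (\<sigma> (?s x)) \<noteq> x}"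
    by (simp add: two_cycles_alt[OF conj_simple_transp_involution[OF i \<sigma>]])
  also have "\<dots> = {?s ` {x, \<sigma> x} | x. \<sigma> x \<noteq> x}"
    by (rule set_eqI, unfold mem_Collect_eq, subst ex_simple_transp[of _ i]) simp
  also have "\<dots> = (`) ?s ` two_cycles n \<sigma>"
    unfolding two_cycles_alt[OF \<sigma>] by (simp only: image_Collect) blast
  finally have "two_cycles n (?s \<circ> \<sigma> \<circ> ?s) = (`) ?s ` two_cycles n \<sigma>" .
  moreover have "inj_on ((`) ?s) (two_cycles n \<sigma>)"
    by (simp add: inj_on_def inj_image_eq_iff[OF bij_is_inj[OF bij_simple_transp]])
  ultimately show ?thesis by (simp only: card_image)
qed

lemma finite_two_cycles: "finite (two_cycles n \<sigma>)"
  by (rule finite_subset[of _ "Pow {1..n}"]) (auto simp: two_cycles_def)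

text \<open>All old cycles avoid \<open>i\<close> and \<open>Suc i\<close>, so they survive, and
  \<open>{i, Suc i}\<close> is the one new cycle.\<close>

lemma two_cycles_simple_transp_comp:
  assumes i: "i \<in> {1..<n}" and \<sigma>: "\<sigma> \<in> involutions n" and fixed: "\<sigma> i = i" "\<sigma> (Suc i) = Suc i"
  shows "card (two_cycles n (simple_transp i \<circ> \<sigma>)) = Suc (card (two_cycles n \<sigma>))"
proof -
  let ?s = "simple_transp i"
  note D = involutionsD[OF \<sigma>]
  have inv: "?s \<circ> \<sigma> \<in> involutions n"
    using simple_transp_comp_involution[OF i \<sigma>] fixed by simp
  have same: "?s (\<sigma> x) = \<sigma> x" if "x \<noteq> i" "x \<noteq> Suc i" for x
    using that fixed D(4) by (metis simple_transp_simps(5))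
  have "two_cycles n (?s \<circ> \<sigma>) = insert {i, Suc i} (two_cycles n \<sigma>)" (is "?L = ?R")
  proof
    show "?L \<subseteq> ?R"
    proof
      fix z assume "z \<in> ?L"
      then obtain x where x: "z = {x, ?s (\<sigma> x)}" "?s (\<sigma> x) \<noteq> x"
        by (auto simp: two_cycles_alt[OF inv])
      show "z \<in> ?R"
      proof (cases "x = i \<or> x = Suc i")
        case True
        then show ?thesis using x fixed by auto
      next
        case False
        then show ?thesis using x same[of x] by (auto simp: two_cycles_alt[OF \<sigma>])
      qed
    qed
    show "?R \<subseteq> ?L"
    proof
      fix z assume "z \<in> ?R"
      then consider "z = {i, Suc i}" | x where "z = {x, \<sigma> x}" "\<sigma> x \<noteq> x"
        by (auto simp: two_cycles_alt[OF \<sigma>])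
      then show "z \<in> ?L"
      proof cases
        case 1
        then show ?thesis unfolding two_cycles_alt[OF inv]
          by (auto intro!: exI[of _ i] simp: fixed)
      next
        case 2
        then have "x \<noteq> i" "x \<noteq> Suc i" using fixed by auto
        with 2 same[of x] show ?thesis unfolding two_cycles_alt[OF inv]
          by (auto intro!: exI[of _ x])
      qed
    qed
  qed
  moreover have "{i, Suc i} \<notin> two_cycles n \<sigma>"
    using fixed by (auto simp: two_cycles_alt[OF \<sigma>] doubleton_eq_iff)
  ultimately show ?thesis by (simp add: finite_two_cycles)
qed

text \<open>Twice \<open>L_stat\<close>, kept in the natural numbers so that no question of parity
  or division arises.\<close>

definition double_L :: "nat \<Rightarrow> (nat \<Rightarrow> nat) \<Rightarrow> nat" where
  "double_L n \<pi> = coxeter_length n \<pi> + card (two_cycles n \<pi>)"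

lemma double_L_id [simp]: "double_L n id = 0"
proof -
  have "two_cycles n id = {}" by (auto simp: two_cycles_def)
  then show ?thesis by (simp add: double_L_def)
qed

text \<open>Creating a cycle adds one inversion and one two-cycle; conjugating adds two inversions
  and no cycle.\<close>

lemma double_L_m_simple:
  assumes i: "i \<in> {1..<n}" and \<sigma>: "\<sigma> \<in> involutions n" and asc: "\<sigma> i < \<sigma> (Suc i)"
  shows "double_L n (m_simple n i \<sigma>) = double_L n \<sigma> + 2"
proof (cases "\<sigma> i = i \<and> \<sigma> (Suc i) = Suc i")
  case True
  then show ?thesis
    using coxeter_length_simple_transp_comp(1)[OF i involutionsD(1)[OF \<sigma>]]
      two_cycles_simple_transp_comp[OF i \<sigma>]
    by (simp add: m_simple_eq[OF i \<sigma>] double_L_def involutionsD(3)[OF \<sigma>])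
next
  case False
  then show ?thesis
    using asc coxeter_length_conj[OF i \<sigma> asc False] two_cycles_conj[OF i \<sigma>]
    by (auto simp: m_simple_eq[OF i \<sigma>] double_L_def)
qed

lemma foldr_m_simple_involution:
  assumes "set is \<subseteq> {1..<n}"
  shows "foldr (m_simple n) is id \<in> involutions n"
  using assms by (induction "is") (auto simp: id_in_involutions intro!: m_simple_involution)

text \<open>A letter adds 2 at an ascent and nothing otherwise, so equality forces every letter to
  act at an ascent.\<close>

lemma double_L_foldr_le:
  assumes "set is \<subseteq> {1..<n}"
  shows "double_L n (foldr (m_simple n) is id) \<le> 2 * length is"
  using assms
proof (induction "is")
  case (Cons i "is")
  define \<tau> where "\<tau> = foldr (m_simple n) is id"
  have \<tau>: "\<tau> \<in> involutions n"
    unfolding \<tau>_def by (rule foldr_m_simple_involution) (use Cons.prems in simp)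
  have i: "i \<in> {1..<n}" using Cons.prems by simp
  have "double_L n \<tau> \<le> 2 * length is"
    unfolding \<tau>_def by (rule Cons.IH) (use Cons.prems in simp)
  moreover have "double_L n (m_simple n i \<tau>) \<le> double_L n \<tau> + 2"
    using double_L_m_simple[OF i \<tau>] m_simple_eq[OF i \<tau>]
    by (cases "\<tau> i < \<tau> (Suc i)") auto
  ultimately have "double_L n (foldr (m_simple n) (i # is) id) \<le> 2 * length (i # is)"
    by (simp add: \<tau>_def)
  then show ?case .
qed simp

subsection \<open>The conditions along a reduced word\<close>

text \<open>The argument \<open>P\<close> plays the role of \<open>w\<^sup>-\<^sup>1\<close>; the last clause merges the conditions (2)-(5).\<close>

definition W_cond :: "(nat \<Rightarrow> nat) \<Rightarrow> (nat \<Rightarrow> nat) \<Rightarrow> bool" where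
  "W_cond \<pi> P \<longleftrightarrow>
     (\<forall>x. x < \<pi> x \<longrightarrow> P (\<pi> x) < P x) \<and>
     (\<forall>x z. x < z \<and> z < \<pi> x \<longrightarrow> \<not> (P (\<pi> x) < P z \<and> P z < P x)) \<and>
     (\<forall>x y. x \<le> \<pi> x \<and> y \<le> \<pi> y \<and> x < y \<and> \<pi> x < \<pi> y \<longrightarrow> P x < P (\<pi> y))"

lemma W_condD:
  assumes "W_cond \<pi> P"
  shows "x < \<pi> x \<Longrightarrow> P (\<pi> x) < P x"
    and "x < z \<Longrightarrow> z < \<pi> x \<Longrightarrow> \<not> (P (\<pi> x) < P z \<and> P z < P x)"
    and "x \<le> \<pi> x \<Longrightarrow> y \<le> \<pi> y \<Longrightarrow> x < y \<Longrightarrow> \<pi> x < \<pi> y \<Longrightarrow> P x < P (\<pi> y)"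
  using assms by (auto simp: W_cond_def)

text \<open>If \<pi> had an ascent at \<open>i\<close>, the third clause for the cycles through
  \<open>i\<close> and \<open>Suc i\<close>, with the first clause inside these cycles, would give
  \<open>P i < P (Suc i)\<close>. The cases record which of the two points is the smaller element of
  its cycle.\<close>

lemma W_cond_descent:
  assumes \<pi>: "\<And>x. \<pi> (\<pi> x) = x" and W: "W_cond \<pi> P" and desc: "P (Suc i) < P i"
  shows "\<pi> (Suc i) < \<pi> i"
proof (rule ccontr)
  assume "\<not> ?thesis"
  moreover have "\<pi> i \<noteq> \<pi> (Suc i)" by (metis \<pi> n_not_Suc_n)
  ultimately have asc: "\<pi> i < \<pi> (Suc i)" by simp
  then have ne: "\<pi> (Suc i) \<noteq> i" using \<pi>[of "Suc i"] by auto
  have Suc_le: "P (\<pi> (Suc i)) \<le> P (Suc i)" if "Suc i \<le> \<pi> (Suc i)"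
    using that W_condD(1)[OF W, of "Suc i"] by (cases "\<pi> (Suc i) = Suc i") auto
  show False
  proof (cases "i \<le> \<pi> i")
    case True
    with asc have "Suc i \<le> \<pi> (Suc i)" by simp
    with True asc W_condD(3)[OF W, of i "Suc i"] Suc_le desc show False by simp
  next
    case False
    then have lt: "P i < P (\<pi> i)" using W_condD(1)[OF W, of "\<pi> i"] \<pi> by simp
    show False
    proof (cases "Suc i \<le> \<pi> (Suc i)")
      case True
      then show False
        using W_condD(3)[OF W, of "\<pi> i" "Suc i"] False \<pi> Suc_le desc lt by simp
    next
      case F: False
      then show False
        using W_condD(3)[OF W, of "\<pi> i" "\<pi> (Suc i)"] False \<pi> ne asc desc lt by simp
    qed
  qed
qed

section \<open>Invariance of the conditions under one step of the action\<close>

text \<open>Conjugation relabels \<open>i\<close> and \<open>Suc i\<close> in the cycles and in the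
  one-line notation alike. Only instances comparing \<open>i\<close> with \<open>Suc i\<close>
  directly can appear or disappear, and each of these is recovered from the other clauses and
  \<open>Q i < Q (Suc i)\<close>.\<close>

lemma W_cond_conj_simple_transp:
  assumes \<sigma>: "\<And>x. \<sigma> (\<sigma> x) = x" and Q: "inj Q" and Qi: "Q i < Q (Suc i)"
    and asc: "\<sigma> i < \<sigma> (Suc i)" and nf: "\<not> (\<sigma> i = i \<and> \<sigma> (Suc i) = Suc i)"
  shows "W_cond (simple_transp i \<circ> \<sigma> \<circ> simple_transp i) (Q \<circ> simple_transp i) \<longleftrightarrow> W_cond \<sigma> Q"
proof -
  let ?s = "simple_transp i"
  have ne: "\<sigma> i \<noteq> Suc i" "\<sigma> (Suc i) \<noteq> i"
    using \<sigma>[of i] \<sigma>[of "Suc i"] asc by auto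
  \<comment> \<open>Since \<sigma> does not exchange \<open>i\<close> and \<open>Suc i\<close>, the
    smaller element of each cycle stays the smaller one.\<close>
  have less_cycle: "?s x < ?s (\<sigma> x) \<longleftrightarrow> x < \<sigma> x" for x
    using ne by (auto simp: simple_transp_less_iff)
  have le_cycle: "?s x \<le> ?s (\<sigma> x) \<longleftrightarrow> x \<le> \<sigma> x" for x
    using less_cycle[of x] by (auto simp: le_less)
  have conj: "W_cond (?s \<circ> \<sigma> \<circ> ?s) (Q \<circ> ?s) \<longleftrightarrow>
     (\<forall>x. x < \<sigma> x \<longrightarrow> Q (\<sigma> x) < Q x) \<and>
     (\<forall>x z. ?s x < ?s z \<and> ?s z < ?s (\<sigma> x) \<longrightarrow> \<not> (Q (\<sigma> x) < Q z \<and> Q z < Q x)) \<and>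
     (\<forall>x y. x \<le> \<sigma> x \<and> y \<le> \<sigma> y \<and> ?s x < ?s y \<and> ?s (\<sigma> x) < ?s (\<sigma> y) \<longrightarrow> Q x < Q (\<sigma> y))"
    (is "_ \<longleftrightarrow> ?A \<and> ?B \<and> ?E")
    unfolding W_cond_def
    by (subst all_simple_transp[of _ i], subst (2 3 4 5) all_simple_transp[of _ i])
      (simp add: less_cycle le_cycle)
  show ?thesis
  proof
    assume W: "W_cond \<sigma> Q"
    note W' = W_condD[OF W]
    \<comment> \<open>\<open>up\<close> and \<open>down\<close> settle the two new instances of
      \<open>?B\<close>, where the exchange moves \<open>z\<close> into the interval of a
      cycle.\<close>
    have up: "Q i < Q (\<sigma> (Suc i))" if "Suc i < \<sigma> (Suc i)"
    proof (cases "i \<le> \<sigma> i")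
      case True
      with W'(3)[of i "Suc i"] asc that show ?thesis by simp
    next
      case False
      with W'(1)[of "\<sigma> i"] W'(3)[of "\<sigma> i" "Suc i"] that \<sigma> show ?thesis by simp
    qed
    have down: "Q (\<sigma> i) < Q (Suc i)" if "\<sigma> i < i"
    proof (cases "\<sigma> (Suc i) \<le> Suc i")
      case True
      with W'(3)[of "\<sigma> i" "\<sigma> (Suc i)"] asc that \<sigma> show ?thesis by simp
    next
      case False
      with W'(1)[of "Suc i"] W'(3)[of "\<sigma> i" "Suc i"] that \<sigma> show ?thesis by simp
    qed
    have ?A using W' by blast
    moreover have ?B
    proof (intro allI impI)
      fix x z assume xz: "?s x < ?s z \<and> ?s z < ?s (\<sigma> x)"
      consider "x = Suc i" "z = i" | "\<sigma> x = i" "z = Suc i" | "x < z" "z < \<sigma> x"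
        using xz by (auto simp: simple_transp_less_iff)
      then show "\<not> (Q (\<sigma> x) < Q z \<and> Q z < Q x)"
      proof cases
        case 1
        then have "Suc i < \<sigma> (Suc i)" using xz less_cycle by (metis less_trans)
        then show ?thesis using up 1 by simp
      next
        case 2
        then have x: "x = \<sigma> i" using \<sigma>[of x] by simp
        then have "\<sigma> i < i" using xz 2 less_cycle[of x] by auto
        then show ?thesis using down 2 x by simp
      next
        case 3
        then show ?thesis by (rule W'(2))
      qed
    qed
    moreover have ?E
    proof (intro allI impI)
      fix x y assume xy: "x \<le> \<sigma> x \<and> y \<le> \<sigma> y \<and> ?s x < ?s y \<and> ?s (\<sigma> x) < ?s (\<sigma> y)"
      \<comment> \<open>\<open>?E\<close> gains no instance: reversing one of the two comparisons
        contradicts the other, by the ascent of \<sigma>.\<close>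
      have "(x, y) \<noteq> (Suc i, i)" "(\<sigma> x, \<sigma> y) \<noteq> (Suc i, i)"
        using xy asc ne nf \<sigma>[of x] \<sigma>[of y] by (auto simp: simple_transp_less_iff)
      then show "Q x < Q (\<sigma> y)"
        using xy W'(3)[of x y] by (auto simp: simple_transp_less_iff)
    qed
    ultimately show "W_cond (?s \<circ> \<sigma> \<circ> ?s) (Q \<circ> ?s)" using conj by blast
  next
    assume "W_cond (?s \<circ> \<sigma> \<circ> ?s) (Q \<circ> ?s)"
    then have W: ?A ?B ?E using conj by blast+
    \<comment> \<open>In this direction \<open>up\<close> and \<open>down\<close> come from
      \<open>?B\<close>, and they supply the instances of the third clause that \<open>?E\<close>
      lacks.\<close>
    have up: "Q i < Q (\<sigma> (Suc i))" if "Suc i \<le> \<sigma> (Suc i)"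
    proof (cases "\<sigma> (Suc i) = Suc i")
      case False
      then have "?s i < ?s (\<sigma> (Suc i))" "?s (Suc i) < ?s i"
        using that by (auto simp: simple_transp_less_iff)
      with W(2) Qi have "\<not> Q (\<sigma> (Suc i)) < Q i" by blast
      then show ?thesis using injD[OF Q] ne by (metis linorder_neqE_nat)
    qed (use Qi in simp)
    have down: "Q (\<sigma> i) < Q (Suc i)" if "\<sigma> i \<le> i"
    proof (cases "\<sigma> i = i")
      case False
      then have "?s (\<sigma> i) < ?s (Suc i)" "?s (Suc i) < ?s (\<sigma> (\<sigma> i))"
        using that \<sigma> by (auto simp: simple_transp_less_iff)
      with W(2) have "\<not> (Q (\<sigma> (\<sigma> i)) < Q (Suc i) \<and> Q (Suc i) < Q (\<sigma> i))" by blast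
      then show ?thesis using injD[OF Q] ne \<sigma> Qi by (metis linorder_neqE_nat)
    qed (use Qi in simp)
    show "W_cond \<sigma> Q"
      unfolding W_cond_def
    proof (intro conjI)
      show ?A by (rule W(1))
      show "\<forall>x z. x < z \<and> z < \<sigma> x \<longrightarrow> \<not> (Q (\<sigma> x) < Q z \<and> Q z < Q x)"
      proof (intro allI impI)
        fix x z assume xz: "x < z \<and> z < \<sigma> x"
        \<comment> \<open>In the first two cases \<open>z\<close> being between would require
          \<open>Q (Suc i) < Q i\<close>.\<close>
        consider "x = i" "z = Suc i" | "\<sigma> x = Suc i" "z = i" | "?s x < ?s z" "?s z < ?s (\<sigma> x)"
          using xz by (auto simp: simple_transp_less_iff)
        then show "\<not> (Q (\<sigma> x) < Q z \<and> Q z < Q x)"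
          using W(2) Qi by cases auto
      qed
      show "\<forall>x y. x \<le> \<sigma> x \<and> y \<le> \<sigma> y \<and> x < y \<and> \<sigma> x < \<sigma> y \<longrightarrow> Q x < Q (\<sigma> y)"
      proof (intro allI impI)
        fix x y assume xy: "x \<le> \<sigma> x \<and> y \<le> \<sigma> y \<and> x < y \<and> \<sigma> x < \<sigma> y"
        consider "x = i" "y = Suc i" | "\<sigma> x = i" "\<sigma> y = Suc i"
          | "?s x < ?s y" "?s (\<sigma> x) < ?s (\<sigma> y)"
          using xy by (auto simp: simple_transp_less_iff)
        then show "Q x < Q (\<sigma> y)"
        proof cases
          case 1
          then show ?thesis using up xy by simp
        next
          case 2
          then have "x = \<sigma> i" using \<sigma>[of x] by simp
          then show ?thesis using down xy 2 by simp
        next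
          case 3
          then show ?thesis using W(3) xy by blast
        qed
      qed
    qed
  qed
qed

text \<open>Two neighbouring fixed points, in increasing order in the one-line notation, correspond
  to a two-cycle whose larger element comes first.\<close>

lemma W_cond_simple_transp_comp:
  assumes \<sigma>: "\<And>x. \<sigma> (\<sigma> x) = x" and Qi: "Q i < Q (Suc i)"
    and fixed: "\<sigma> i = i" "\<sigma> (Suc i) = Suc i"
  shows "W_cond (simple_transp i \<circ> \<sigma>) (Q \<circ> simple_transp i) \<longleftrightarrow> W_cond \<sigma> Q"
proof -
  let ?s = "simple_transp i"
  define \<pi> where "\<pi> = ?s \<circ> \<sigma>"
  define P where "P = Q \<circ> ?s"
  have \<pi>_i [simp]: "\<pi> i = Suc i" "\<pi> (Suc i) = i" by (simp_all add: \<pi>_def fixed)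
  have \<sigma>_other: "\<sigma> x \<noteq> i \<and> \<sigma> x \<noteq> Suc i" if "x \<noteq> i" "x \<noteq> Suc i" for x
    using that fixed \<sigma>[of x] by auto
  then have \<pi>_other: "\<pi> x = \<sigma> x" if "x \<noteq> i" "x \<noteq> Suc i" for x
    using that by (simp add: \<pi>_def)
  have P_i [simp]: "P i = Q (Suc i)" "P (Suc i) = Q i" by (simp_all add: P_def)
  have P_other: "P x = Q x" if "x \<noteq> i" "x \<noteq> Suc i" for x
    using that by (simp add: P_def)
  have "W_cond \<pi> P" if "W_cond \<sigma> Q"
  proof -
    note W = W_condD[OF that]
    show ?thesis unfolding W_cond_def
    proof (intro conjI allI impI)
      fix x assume "x < \<pi> x"
      then show "P (\<pi> x) < P x"
        using W(1)[of x] \<sigma>_other[of x] \<pi>_other[of x] P_other Qi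
        by (cases "x = i \<or> x = Suc i") auto
    next
      fix x z assume xz: "x < z \<and> z < \<pi> x"
      \<comment> \<open>An interval spanned by another cycle contains both of \<open>i\<close> and
        \<open>Suc i\<close> or neither, so exchanging their positions is harmless.\<close>
      then have x: "x \<noteq> i" "x \<noteq> Suc i" by auto
      show "\<not> (P (\<pi> x) < P z \<and> P z < P x)"
        using xz x W(2)[of x z] W(2)[of x i] W(2)[of x "Suc i"] \<sigma>_other[OF x] \<pi>_other[OF x]
          P_other[of x] P_other[of z] P_other[of "\<sigma> x"]
        by (cases "z = i"; cases "z = Suc i") auto
    next
      fix x y assume xy: "x \<le> \<pi> x \<and> y \<le> \<pi> y \<and> x < y \<and> \<pi> x < \<pi> y"
      then have "x \<noteq> Suc i" "y \<noteq> Suc i" by auto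
      \<comment> \<open>For \<open>x = i\<close> the new cycle inherits the condition of the fixed
        point \<open>Suc i\<close>, for \<open>y = i\<close> that of the fixed point
        \<open>i\<close>.\<close>
      then show "P x < P (\<pi> y)"
        using xy W(3)[of x y] W(3)[of "Suc i" y] W(3)[of x i] fixed \<sigma>_other[of x] \<sigma>_other[of y]
          \<pi>_other[of x] \<pi>_other[of y] P_other[of x] P_other[of "\<sigma> y"]
        by (cases "x = i"; cases "y = i") auto
    qed
  qed
  moreover have "W_cond \<sigma> Q" if "W_cond \<pi> P"
  proof -
    note W = W_condD[OF that]
    show ?thesis unfolding W_cond_def
    proof (intro conjI allI impI)
      fix x assume "x < \<sigma> x"
      then show "Q (\<sigma> x) < Q x"
        using W(1)[of x] \<sigma>_other[of x] \<pi>_other[of x] P_other[of x] P_other[of "\<sigma> x"] fixed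
        by (cases "x = i \<or> x = Suc i") auto
    next
      fix x z assume xz: "x < z \<and> z < \<sigma> x"
      then have x: "x \<noteq> i" "x \<noteq> Suc i" using fixed by auto
      show "\<not> (Q (\<sigma> x) < Q z \<and> Q z < Q x)"
        using xz x W(2)[of x z] W(2)[of x i] W(2)[of x "Suc i"] \<sigma>_other[OF x] \<pi>_other[OF x]
          P_other[of x] P_other[of z] P_other[of "\<sigma> x"]
        by (cases "z = i"; cases "z = Suc i") auto
    next
      fix x y assume xy: "x \<le> \<sigma> x \<and> y \<le> \<sigma> y \<and> x < y \<and> \<sigma> x < \<sigma> y"
      \<comment> \<open>The cycle yields the stronger of the conditions on the two fixed points; the
        weaker one follows by \<open>Q i < Q (Suc i)\<close>.\<close>
      have lower: "Q (Suc i) < Q (\<sigma> y)" if "Suc i < y" "y \<le> \<sigma> y"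
        using that W(3)[of i y] \<sigma>_other[of y] \<pi>_other[of y] P_other[of "\<sigma> y"] by simp
      have upper: "Q x < Q i" if "x < i" "\<sigma> x < i" "x \<le> \<sigma> x"
        using that W(3)[of x i] \<pi>_other[of x] P_other[of x] by simp
      have "x = i \<and> y = Suc i" if "x \<in> {i, Suc i}" "y \<in> {i, Suc i}"
        using that xy by auto
      then consider "x = i" "y = Suc i" | "x \<in> {i, Suc i}" "y \<notin> {i, Suc i}"
        | "y \<in> {i, Suc i}" "x \<notin> {i, Suc i}" | "x \<notin> {i, Suc i}" "y \<notin> {i, Suc i}"
        by blast
      then show "Q x < Q (\<sigma> y)"
      proof cases
        case 1
        then show ?thesis using Qi fixed by simp
      next
        case 2
        then show ?thesis using lower xy Qi by auto
      next
        case 3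
        then have "x < i" "\<sigma> x < i" using xy fixed \<sigma>_other[of x] by auto
        then show ?thesis using upper xy Qi fixed 3 by auto
      next
        case 4
        then show ?thesis
          using W(3)[of x y] xy \<sigma>_other[of x] \<sigma>_other[of y] \<pi>_other[of x] \<pi>_other[of y]
            P_other[of x] P_other[of "\<sigma> y"] by auto
      qed
    qed
  qed
  ultimately show ?thesis unfolding \<pi>_def P_def by blast
qed

lemma W_cond_m_simple:
  assumes i: "i \<in> {1..<n}" and \<sigma>: "\<sigma> \<in> involutions n" and asc: "\<sigma> i < \<sigma> (Suc i)"
    and Q: "inj Q" "Q i < Q (Suc i)"
  shows "W_cond (m_simple n i \<sigma>) (Q \<circ> simple_transp i) \<longleftrightarrow> W_cond \<sigma> Q"
proof (cases "\<sigma> i = i \<and> \<sigma> (Suc i) = Suc i")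
  case True
  then show ?thesis
    using W_cond_simple_transp_comp[OF involutionsD(2)[OF \<sigma>] Q(2)]
    by (simp add: m_simple_eq[OF i \<sigma>])
next
  case False
  then show ?thesis
    using W_cond_conj_simple_transp[OF involutionsD(2)[OF \<sigma>] Q asc False] asc
    by (auto simp: m_simple_eq[OF i \<sigma>])
qed

section \<open>Induction along a reduced word\<close>

text \<open>The case of the empty word: for \<open>P = id\<close> the first clause excludes every
  two-cycle.\<close>

lemma W_cond_id_iff:
  assumes "\<And>x. \<pi> (\<pi> x) = x"
  shows "W_cond \<pi> id \<longleftrightarrow> \<pi> = id"
proof
  assume "W_cond \<pi> id"
  then have *: "\<not> x < \<pi> x" for x using W_condD(1)[of \<pi> id x] by auto
  moreover have "\<not> \<pi> x < x" for x using *[of "\<pi> x"] assms by simp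
  ultimately have "\<pi> x = x" for x by (metis linorder_neqE_nat)
  then show "\<pi> = id" by (simp add: fun_eq_iff)
qed (simp add: W_cond_def)

text \<open>The involution stays arbitrary in the induction, because removing the first letter
  replaces \<pi> by a preimage under the corresponding operator.\<close>

lemma reduced_word_W_cond_iff:
  assumes "reduced_word n w is" "\<pi> \<in> involutions n"
  shows "foldr (m_simple n) is id = \<pi> \<and> 2 * length is = double_L n \<pi> \<longleftrightarrow> W_cond \<pi> (inv w)"
  using assms
proof (induction "is" arbitrary: w \<pi>)
  case Nil
  have "w = id" using Nil.prems(1) by (simp add: reduced_word_def)
  moreover have "W_cond \<pi> id \<longleftrightarrow> \<pi> = id"
    by (rule W_cond_id_iff[OF involutionsD(2)[OF Nil.prems(2)]])
  ultimately have "foldr (m_simple n) [] id = \<pi> \<and> 2 * length [] = double_L n \<pi> \<longleftrightarrow> W_cond \<pi> (inv w)"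
    by (cases "\<pi> = id") auto
  then show ?case .
next
  case (Cons i js)
  define u where "u = word_prod js"
  define \<tau> where "\<tau> = foldr (m_simple n) js id"
  note red = reduced_word_Cons[OF Cons.prems(1), folded u_def]
  note i = red(1)
  have js: "set js \<subseteq> {1..<n}" using red(2) by (simp add: reduced_word_def)
  have u: "u permutes {1..n}" unfolding u_def by (rule word_prod_permutes[OF js])
  have inj: "inj (inv u)" by (rule permutes_inj[OF permutes_inv[OF u]])
  have inv_w: "inv w = inv u \<circ> simple_transp i"
    by (simp add: red(3) o_inv_distrib bij_simple_transp permutes_bij[OF u])
  have \<tau>: "\<tau> \<in> involutions n" unfolding \<tau>_def by (rule foldr_m_simple_involution[OF js])
  have \<tau>_le: "double_L n \<tau> \<le> 2 * length js" unfolding \<tau>_def by (rule double_L_foldr_le[OF js])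
  have IH: "\<tau> = \<rho> \<and> 2 * length js = double_L n \<rho> \<longleftrightarrow> W_cond \<rho> (inv u)"
    if "\<rho> \<in> involutions n" for \<rho>
    unfolding \<tau>_def by (rule Cons.IH[OF red(2) that])
  show ?case
  proof
    assume "foldr (m_simple n) (i # js) id = \<pi> \<and> 2 * length (i # js) = double_L n \<pi>"
    then have \<pi>: "\<pi> = m_simple n i \<tau>" and len: "double_L n \<pi> = 2 * length js + 2"
      by (auto simp: \<tau>_def)
    \<comment> \<open>If the first letter acted trivially, the statistic would stay at most
      \<open>2 * length js\<close>, short by 2.\<close>
    have asc: "\<tau> i < \<tau> (Suc i)"
      using \<pi> len \<tau>_le m_simple_eq[OF i \<tau>] by (auto split: if_splits)
    then have "2 * length js = double_L n \<tau>"
      using double_L_m_simple[OF i \<tau>] \<pi> len by simp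
    then have "W_cond \<tau> (inv u)" using IH[OF \<tau>] by simp
    then show "W_cond \<pi> (inv w)"
      using W_cond_m_simple[OF i \<tau> asc inj red(4)] by (simp add: \<pi> inv_w)
  next
    assume W: "W_cond \<pi> (inv w)"
    have "inv w (Suc i) < inv w i" using red(4) by (simp add: inv_w)
    then have "\<pi> (Suc i) < \<pi> i"
      using W_cond_descent[OF involutionsD(2)[OF Cons.prems(2)] W] by blast
    then obtain \<sigma> where \<sigma>: "\<sigma> \<in> involutions n" "\<sigma> i < \<sigma> (Suc i)" "m_simple n i \<sigma> = \<pi>"
      using m_simple_preimage[OF i Cons.prems(2)] by blast
    then have "W_cond \<sigma> (inv u)"
      using W_cond_m_simple[OF i \<sigma>(1,2) inj red(4)] W by (simp add: inv_w)
    \<comment> \<open>The induction hypothesis identifies the chosen preimage with the involution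
      produced by the tail.\<close>
    then have "\<tau> = \<sigma>" "2 * length js = double_L n \<sigma>"
      using IH[OF \<sigma>(1)] by auto
    then show "foldr (m_simple n) (i # js) id = \<pi> \<and> 2 * length (i # js) = double_L n \<pi>"
      using double_L_m_simple[OF i \<sigma>(1,2)] \<sigma>(3) by (simp add: \<tau>_def)
  qed
qed

text \<open>The criterion holds for every reduced word, hence for the one that \<open>SOME\<close>
  selects in \<open>m_act\<close>.\<close>

lemma W_set_eq_W_cond:
  assumes "\<pi> \<in> involutions n"
  shows "W_set n \<pi> = {w. w permutes {1..n} \<and> W_cond \<pi> (inv w)}"
proof -
  have "m_act n w id = \<pi> \<and> of_nat (coxeter_length n w) = L_stat n \<pi> \<longleftrightarrow> W_cond \<pi> (inv w)"
    if "w permutes {1..n}" for w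
  proof -
    have r: "reduced_word n w (SOME is. reduced_word n w is)"
      by (rule someI_ex[OF reduced_word_exists[OF that]])
    have "of_nat (coxeter_length n w) = L_stat n \<pi> \<longleftrightarrow>
        (of_nat (2 * coxeter_length n w) :: rat) = of_nat (double_L n \<pi>)"
      by (auto simp: L_stat_def double_L_def field_simps)
    also have "\<dots> \<longleftrightarrow> 2 * coxeter_length n w = double_L n \<pi>"
      by (rule of_nat_eq_iff)
    finally show ?thesis
      using reduced_word_W_cond_iff[OF r assms] r by (simp add: m_act_def reduced_word_def)
  qed
  then show ?thesis by (auto simp: W_set_def)
qed

subsection \<open>Standard form\<close>

lemma foldr_comp_apply: "foldr (\<lambda>i u. f i \<circ> u) js id x = foldr f js x"
  by (induction js) (simp_all add: comp_def id_def)

lemma foldr_transpose_outside: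
  "x \<notin> a ` set js \<union> b ` set js \<Longrightarrow> foldr (\<lambda>i. transpose (a i) (b i)) js x = x"
  by (induction js) auto

lemma foldr_transpose_apply:
  assumes "inj_on a (set js)" "inj_on b (set js)" "a ` set js \<inter> b ` set js = {}" "distinct js"
    and "i \<in> set js"
  shows "foldr (\<lambda>i. transpose (a i) (b i)) js (a i) = b i"
  using assms
proof (induction js)
  case (Cons j js)
  show ?case
  proof (cases "i = j")
    case True
    have "a j \<notin> a ` set js \<union> b ` set js" using Cons.prems by auto
    then show ?thesis using True by (simp add: foldr_transpose_outside)
  next
    case False
    then have i: "i \<in> set js" using Cons.prems by simp
    have "foldr (\<lambda>i. transpose (a i) (b i)) js (a i) = b i"
    proof (rule Cons.IH)
      show "inj_on a (set js)" "inj_on b (set js)" "distinct js" using Cons.prems by simp_all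
      show "a ` set js \<inter> b ` set js = {}" using Cons.prems(3) unfolding list.set by blast
    qed (rule i)
    moreover have "b i \<noteq> a j" using Cons.prems(3) i unfolding list.set by blast
    moreover have "b i \<noteq> b j" using inj_onD[OF Cons.prems(2), of i j] False i by auto
    ultimately show ?thesis by simp
  qed
qed simp

text \<open>Together with \<open>a i < b i\<close>, this says that \<open>a\<close> lists exactly
  the smaller elements of the two-cycles.\<close>

lemma standard_form_cycles:
  assumes \<pi>: "\<pi> \<in> involutions n" and sf: "standard_form n \<pi> k a b"
  shows "i \<in> {1..k} \<Longrightarrow> \<pi> (a i) = b i"
    and "x < \<pi> x \<Longrightarrow> \<exists>i\<in>{1..k}. x = a i"
proof -
  have set: "set [1..<k + 1] = {1..k}" by auto
  have mono: "strict_mono_on {1..k} a" and inj_b: "inj_on b {1..k}"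
    and disj: "a ` {1..k} \<inter> b ` {1..k} = {}" and ab: "\<And>i. i \<in> {1..k} \<Longrightarrow> a i < b i"
    and \<pi>_eq: "\<pi> = foldr (\<lambda>i u. transpose (a i) (b i) \<circ> u) [1..<k + 1] id"
    using sf unfolding standard_form_def by blast+
  have inj_a: "inj_on a {1..k}" by (rule strict_mono_on_imp_inj_on[OF mono])
  show A: "\<pi> (a i) = b i" if "i \<in> {1..k}" for i
    unfolding \<pi>_eq foldr_comp_apply
    by (rule foldr_transpose_apply) (use inj_a inj_b disj that in \<open>simp_all only: set distinct_upt\<close>)
  have out: "\<pi> x = x" if "x \<notin> a ` {1..k} \<union> b ` {1..k}" for x
    unfolding \<pi>_eq foldr_comp_apply
    by (rule foldr_transpose_outside) (unfold set, rule that)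
  show "\<exists>i\<in>{1..k}. x = a i" if "x < \<pi> x"
  proof (rule ccontr)
    assume "\<not> ?thesis"
    \<comment> \<open>A moved point that is no \<open>a i\<close> must be some \<open>b i\<close>,
      and \<pi> sends that downwards.\<close>
    with out that obtain i where i: "i \<in> {1..k}" "x = b i" by (metis UnE imageE less_irrefl)
    then have "\<pi> x = a i" using A involutionsD(2)[OF \<pi>] by metis
    then show False using that i ab[of i] by simp
  qed
qed

section \<open>Matching the listed conditions with \<open>W_cond\<close>\<close>

text \<open>Monotonicity of \<open>a\<close> and \<open>c\<close> translates indices into elements,
  and \<open>?C2\<close> to \<open>?C5\<close> cover the four kinds of pairs in the third clause.
  For a mixed pair one inequality suffices, since \<open>a i < b i\<close> gives the other.\<close>

lemma occurs_conditions_iff_W_cond: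
  assumes \<pi>: "\<pi> \<in> involutions n" and sf: "standard_form n \<pi> k a b"
    and fp: "fixed_points_listed n \<pi> l c" and w: "w permutes {1..n}"
  shows "(\<forall>i\<in>{1..k}. occurs_before w (b i) (a i) \<and>
        (\<forall>x. a i < x \<and> x < b i \<longrightarrow> \<not> occurs_between w x (b i) (a i))) \<and>
     (\<forall>i\<in>{1..k}. \<forall>j\<in>{1..k}. i < j \<and> b i < b j \<longrightarrow> occurs_before w (a i) (b j)) \<and>
     (\<forall>i\<in>{1..l}. \<forall>j\<in>{1..l}. i < j \<longrightarrow> occurs_before w (c i) (c j)) \<and>
     (\<forall>i\<in>{1..k}. \<forall>j\<in>{1..l}. c j < a i \<longrightarrow> occurs_before w (c j) (b i)) \<and>
     (\<forall>i\<in>{1..k}. \<forall>j\<in>{1..l}. b i < c j \<longrightarrow> occurs_before w (a i) (c j))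
     \<longleftrightarrow> W_cond \<pi> (inv w)"
    (is "?C1 \<and> ?C2 \<and> ?C3 \<and> ?C4 \<and> ?C5 \<longleftrightarrow> _")
proof -
  note D = involutionsD[OF \<pi>]
  note \<pi>_a = standard_form_cycles(1)[OF \<pi> sf] and ex_a = standard_form_cycles(2)[OF \<pi> sf]
  have ab: "\<And>i. i \<in> {1..k} \<Longrightarrow> a i < b i" using sf by (simp add: standard_form_def)
  have a_less: "a i < a j \<longleftrightarrow> i < j" if "i \<in> {1..k}" "j \<in> {1..k}" for i j
    using sf that strict_mono_on_less[of "{1..k}" a i j] by (simp add: standard_form_def)
  have c_less: "c i < c j \<longleftrightarrow> i < j" if "i \<in> {1..l}" "j \<in> {1..l}" for i j
    using fp that strict_mono_on_less[of "{1..l}" c i j] by (simp add: fixed_points_listed_def)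
  have c_image: "c ` {1..l} = {x \<in> {1..n}. \<pi> x = x}"
    using fp by (simp add: fixed_points_listed_def)
  then have \<pi>_c: "\<pi> (c j) = c j" if "j \<in> {1..l}" for j using that by blast
  have ex_c: "\<exists>j\<in>{1..l}. x = c j" if "\<pi> x = x" "x \<in> {1..n}" for x
    using c_image that by blast
  let ?P = "inv w"
  have P_in: "?P x \<in> {1..n} \<longleftrightarrow> x \<in> {1..n}" for x by (rule permutes_in_image[OF permutes_inv[OF w]])
  have P_out: "?P x = x" if "x \<notin> {1..n}" for x by (rule permutes_not_in[OF permutes_inv[OF w] that])
  show ?thesis
  proof
    assume C: "?C1 \<and> ?C2 \<and> ?C3 \<and> ?C4 \<and> ?C5"
    show "W_cond \<pi> ?P"
      unfolding W_cond_def
    proof (intro conjI allI impI)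
      fix x assume "x < \<pi> x"
      with ex_a \<pi>_a C show "?P (\<pi> x) < ?P x" by (fastforce simp: occurs_before_def)
    next
      fix x z assume xz: "x < z \<and> z < \<pi> x"
      then obtain i where "i \<in> {1..k}" "x = a i" using ex_a[of x] by auto
      with \<pi>_a C xz show "\<not> (?P (\<pi> x) < ?P z \<and> ?P z < ?P x)"
        by (auto simp: occurs_before_def occurs_between_def)
    next
      fix x y assume xy: "x \<le> \<pi> x \<and> y \<le> \<pi> y \<and> x < y \<and> \<pi> x < \<pi> y"
      \<comment> \<open>\<open>W_cond\<close> ranges over all natural numbers, so points outside
        \<open>{1..n}\<close> are treated separately.\<close>
      consider "x \<notin> {1..n}" | "y \<notin> {1..n}" "x \<in> {1..n}"
        | i where "i \<in> {1..k}" "x = a i" "y \<in> {1..n}" | "\<pi> x = x" "x \<in> {1..n}" "y \<in> {1..n}"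
        using xy ex_a[of x] by (metis le_less)
      then show "?P x < ?P (\<pi> y)"
      proof cases
        case 1
        then have "\<pi> x = x" by (rule permutes_not_in[OF D(1)])
        \<comment> \<open>If \<open>\<pi> y\<close> lies in \<open>{1..n}\<close>, then
          \<open>x = 0\<close>; otherwise \<open>inv w\<close> fixes both \<open>x\<close> and
          \<open>\<pi> y\<close>.\<close>
        then show ?thesis using 1 xy P_out[of x] P_in[of "\<pi> y"] P_out[of "\<pi> y"]
          by (cases "\<pi> y \<in> {1..n}") auto
      next
        case 2
        then have "\<pi> y = y" by (intro permutes_not_in[OF D(1)])
        then show ?thesis using 2 xy P_out[of y] P_in[of x] by auto
      next
        case 3
        \<comment> \<open>\<open>x\<close> is the smaller element of a two-cycle: \<open>?C5\<close>
          applies if \<open>y\<close> is fixed, \<open>?C2\<close> otherwise.\<close>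
        note i = this
        show ?thesis
        proof (cases "\<pi> y = y")
          case True
          with ex_c i obtain j where "j \<in> {1..l}" "y = c j" by blast
          with i C True xy \<pi>_a[of i] show ?thesis by (auto simp: occurs_before_def)
        next
          case False
          with ex_a xy obtain j where "j \<in> {1..k}" "y = a j" by (metis le_less)
          with i C xy \<pi>_a[of i] \<pi>_a[of j] a_less[of i j] show ?thesis
            by (auto simp: occurs_before_def)
        qed
      next
        case 4
        \<comment> \<open>\<open>x\<close> is a fixed point: \<open>?C3\<close> applies if
          \<open>y\<close> is fixed, \<open>?C4\<close> otherwise.\<close>
        then obtain i where i: "i \<in> {1..l}" "x = c i" using ex_c by blast
        show ?thesis
        proof (cases "\<pi> y = y")
          case True
          with ex_c 4 obtain j where "j \<in> {1..l}" "y = c j" by blast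
          with i C True xy c_less[of i j] show ?thesis by (auto simp: occurs_before_def)
        next
          case False
          with ex_a xy obtain j where "j \<in> {1..k}" "y = a j" by (metis le_less)
          with i C xy \<pi>_a[of j] show ?thesis by (auto simp: occurs_before_def)
        qed
      qed
    qed
  next
    assume "W_cond \<pi> ?P"
    note W = W_condD[OF this]
    have ?C1
    proof (intro ballI conjI allI impI)
      fix i assume i: "i \<in> {1..k}"
      then have before: "?P (b i) < ?P (a i)" using W(1)[of "a i"] \<pi>_a[OF i] ab[OF i] by simp
      then show "occurs_before w (b i) (a i)" by (simp add: occurs_before_def)
      fix x assume "a i < x \<and> x < b i"
      \<comment> \<open>\<open>occurs_between\<close> is symmetric in its last two arguments;
        \<open>before\<close> rules out the order with \<open>a i\<close> first.\<close>
      then show "\<not> occurs_between w x (b i) (a i)"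
        using W(2)[of "a i" x] \<pi>_a[OF i] before by (auto simp: occurs_before_def occurs_between_def)
    qed
    moreover have ?C2
    proof (intro ballI impI)
      fix i j assume "i \<in> {1..k}" "j \<in> {1..k}" "i < j \<and> b i < b j"
      then show "occurs_before w (a i) (b j)"
        using W(3)[of "a i" "a j"] \<pi>_a[of i] \<pi>_a[of j] ab[of i] ab[of j] a_less[of i j]
        by (simp add: occurs_before_def)
    qed
    moreover have ?C3
    proof (intro ballI impI)
      fix i j assume "i \<in> {1..l}" "j \<in> {1..l}" "i < j"
      then show "occurs_before w (c i) (c j)"
        using W(3)[of "c i" "c j"] \<pi>_c[of i] \<pi>_c[of j] c_less[of i j]
        by (simp add: occurs_before_def)
    qed
    moreover have ?C4
    proof (intro ballI impI)
      fix i j assume "i \<in> {1..k}" "j \<in> {1..l}" "c j < a i"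
      then show "occurs_before w (c j) (b i)"
        using W(3)[of "c j" "a i"] \<pi>_a[of i] \<pi>_c[of j] ab[of i] by (simp add: occurs_before_def)
    qed
    moreover have ?C5
    proof (intro ballI impI)
      fix i j assume "i \<in> {1..k}" "j \<in> {1..l}" "b i < c j"
      then show "occurs_before w (a i) (c j)"
        using W(3)[of "a i" "c j"] \<pi>_a[of i] \<pi>_c[of j] ab[of i] by (simp add: occurs_before_def)
    qed
    ultimately show "?C1 \<and> ?C2 \<and> ?C3 \<and> ?C4 \<and> ?C5" by blast
  qed
qed

theorem theorem2p3:
  fixes n k l :: nat and \<pi> a b c :: "nat \<Rightarrow> nat"
  assumes "n \<ge> 1"
    and "\<pi> \<in> involutions n"
    and "standard_form n \<pi> k a b"
    and "fixed_points_listed n \<pi> l c"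
  shows "W_set n \<pi> = {w. w permutes {1..n} \<and>
     (\<forall>i\<in>{1..k}. occurs_before w (b i) (a i) \<and>
        (\<forall>x. a i < x \<and> x < b i \<longrightarrow> \<not> occurs_between w x (b i) (a i))) \<and>
     (\<forall>i\<in>{1..k}. \<forall>j\<in>{1..k}. i < j \<and> b i < b j \<longrightarrow> occurs_before w (a i) (b j)) \<and>
     (\<forall>i\<in>{1..l}. \<forall>j\<in>{1..l}. i < j \<longrightarrow> occurs_before w (c i) (c j)) \<and>
     (\<forall>i\<in>{1..k}. \<forall>j\<in>{1..l}. c j < a i \<longrightarrow> occurs_before w (c j) (b i)) \<and>
     (\<forall>i\<in>{1..k}. \<forall>j\<in>{1..l}. b i < c j \<longrightarrow> occurs_before w (a i) (c j))}"
  unfolding W_set_eq_W_cond[OF assms(2)]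
  using occurs_conditions_iff_W_cond[OF assms(2-4)] by (intro Collect_cong conj_cong refl) (rule sym)

end
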